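(* Let $G=(V,E)$ be a graph. For $v\in V$ let $\delta(v)$ be the set of edges incident to $v$, and for a partition $V_1,\dots,V_k$ of $V$ into nonempty sets let $\delta(V_1,\dots,V_k)$ be the set of edges whose endpoints lie in different parts. Suppose $(\mathbf{x}^*,\mathbf{y}^*,\mathbf{z}^*,\mathbf{t}^* )\in\mathbb{R}^{E}\times\mathbb{R}^{E}\times\mathbb{R}^{E}\times\mathbb{R}^{E}$ satisfies the following constraints: (4.1) $x_e=y_e+2z_e$ for all $e\in E$; (4.2) $\sum_{e\in F}(1-y_e)+\sum_{e\in\delta(v)\setminus F}y_e\ge 1$ for every $v\in V$ and every $F\subseteq\delta(v)$ with $|F|$ odd; (4.3) $\sum_{e\in\delta(V_1,\dots,V_k)}t_e\ge k-1$ for every partition $V_1,\dots,V_k$ of $V$ into nonempty sets; (4.4) $t_e\le y_e+z_e\le 1$ for all $e\in E$; (4.5) $0\le t_e\le 1$ for all $e\in E$; (4.6) $0\le z_e\le 1$ for all $e\in E$; (4.7) $y_e\in\{0,1\}$ for all $e\in E$. Then $\mathbf{x}^*=\mathbf{y}^*+2\mathbf{z}^*$ indicates an edge set that is an Euler tour, or is a convex combination of (incidence vectors of) Euler tours.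
   Context: An Euler tour (GTSP tour) of $G$ is a vector $\boldsymbol{\chi}\in\mathbb{Z}_{\ge 0}^{E}$, interpreted as a multigraph on $V$ using edge $e$ exactly $\chi_e$ times, such that this multigraph is connected, touches every vertex of $V$, and every vertex has even degree in it. *)

theory Defs
  imports Complex_Main "HOL-Library.Disjoint_Sets"
begin

text \<open>A vector indexed by the edge set \<open>E\<close> is represented by a function on the type of
  edges; only its values on \<open>E\<close> are ever used. The empty vertex set is not excluded.\<close>

definition graph :: "'v set \<Rightarrow> 'v set set \<Rightarrow> bool" where
  "graph V E \<longleftrightarrow> finite V \<and> (\<forall>e\<in>E. e \<subseteq> V \<and> card e = 2)"

definition incident_edges :: "'v set set \<Rightarrow> 'v \<Rightarrow> 'v set set" where
  "incident_edges E v = {e \<in> E. v \<in> e}"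

definition crossing_edges :: "'v set set \<Rightarrow> 'v set set \<Rightarrow> 'v set set" where
  "crossing_edges E P =
     {e \<in> E. \<exists>u\<in>e. \<exists>w\<in>e. \<exists>A\<in>P. \<exists>B\<in>P. u \<in> A \<and> w \<in> B \<and> A \<noteq> B}"

definition multigraph_degree :: "'v set set \<Rightarrow> ('v set \<Rightarrow> nat) \<Rightarrow> 'v \<Rightarrow> nat" where
  "multigraph_degree E \<chi> v = (\<Sum>e\<in>incident_edges E v. \<chi> e)"

definition multigraph_adj :: "'v set set \<Rightarrow> ('v set \<Rightarrow> nat) \<Rightarrow> ('v \<times> 'v) set" where
  "multigraph_adj E \<chi> = {(u, w). {u, w} \<in> E \<and> \<chi> {u, w} > 0}"

text \<open>When \<open>V\<close> consists of a single vertex, the tour without edges counts as touching it.\<close>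

definition euler_tour :: "'v set \<Rightarrow> 'v set set \<Rightarrow> ('v set \<Rightarrow> nat) \<Rightarrow> bool" where
  "euler_tour V E \<chi> \<longleftrightarrow>
     (\<forall>u\<in>V. \<forall>w\<in>V. (u, w) \<in> (multigraph_adj E \<chi>)\<^sup>*) \<and>
     (\<forall>v\<in>V. V = {v} \<or> (\<exists>e\<in>incident_edges E v. \<chi> e > 0)) \<and>
     (\<forall>v\<in>V. even (multigraph_degree E \<chi> v))"

definition is_euler_tour_vector :: "'v set \<Rightarrow> 'v set set \<Rightarrow> ('v set \<Rightarrow> real) \<Rightarrow> bool" where
  "is_euler_tour_vector V E x \<longleftrightarrow>
     (\<exists>\<chi>. euler_tour V E \<chi> \<and> (\<forall>e\<in>E. x e = real (\<chi> e)))"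

definition is_convex_comb_of_euler_tours ::
    "'v set \<Rightarrow> 'v set set \<Rightarrow> ('v set \<Rightarrow> real) \<Rightarrow> bool" where
  "is_convex_comb_of_euler_tours V E x \<longleftrightarrow>
     (\<exists>T \<mu>. finite T \<and> (\<forall>\<chi>\<in>T. euler_tour V E \<chi>) \<and>
        (\<forall>\<chi>\<in>T. 0 \<le> \<mu> \<chi>) \<and> (\<Sum>\<chi>\<in>T. \<mu> \<chi>) = (1::real) \<and>
        (\<forall>e\<in>E. x e = (\<Sum>\<chi>\<in>T. \<mu> \<chi> * real (\<chi> e))))"

end

theory Submission
  imports Defs "HOL-Analysis.Function_Topology"
begin

text \<open>Put \<open>w = y + z\<close>. The partition inequalities pass from \<open>t\<close> to \<open>w\<close>, and with \<open>0 \<le> w \<le> 1\<close>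
  they make \<open>w\<close> a convex combination of connected spanning edge sets \<open>C\<close>: otherwise some cost
  function would be strictly cheaper at \<open>w\<close> than at every such \<open>C\<close>, which Kruskal's algorithm
  excludes. Since \<open>w = 1\<close> on \<open>Y = {e. y e = 1}\<close>, each \<open>C\<close> contains \<open>Y\<close>, and taking the edges of
  \<open>Y\<close> once and those of \<open>C - Y\<close> twice is an Euler tour, as (4.2) makes all degrees in \<open>Y\<close>
  even. Weighted in this way, \<open>w\<close> becomes \<open>x\<close>.\<close>

section \<open>Convex combinations and separating functionals\<close>

text \<open>The index type may be infinite, so weights are pinned to 0 outside \<open>I\<close>. The
  set is then a closed part of a product of compact sets, compact by Tychonoff, and a continuous
  function attains its minimum on it.\<close>

lemma compact_simplex:
  fixes I :: "'i set"
  assumes "finite I"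
  shows "compact {\<mu> :: 'i \<Rightarrow> real. (\<forall>i. 0 \<le> \<mu> i) \<and> (\<forall>i. i \<notin> I \<longrightarrow> \<mu> i = 0) \<and> sum \<mu> I = 1}"
    (is "compact ?S")
proof -
  define B where "B = (\<lambda>i. if i \<in> I then {0..1::real} else {0})"
  have "compactin (product_topology (\<lambda>_::'i. euclidean) UNIV) (PiE UNIV B)"
    by (subst compactin_PiE) (auto simp: B_def)
  then have comp: "compact (PiE UNIV B)"
    by (simp add: euclidean_product_topology)
  have "?S = PiE UNIV B \<inter> {\<mu>. sum \<mu> I = 1}"
  proof (intro equalityI subsetI)
    fix \<mu> assume \<mu>: "\<mu> \<in> ?S"
    have "\<mu> i \<le> 1" if "i \<in> I" for i
      using member_le_sum[of i I \<mu>] that \<mu> assms by auto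
    then show "\<mu> \<in> PiE UNIV B \<inter> {\<mu>. sum \<mu> I = 1}"
      using \<mu> by (auto simp: B_def)
  next
    fix \<mu> assume \<mu>: "\<mu> \<in> PiE UNIV B \<inter> {\<mu>. sum \<mu> I = 1}"
    then have "\<mu> i \<in> B i" for i by auto
    then have "0 \<le> \<mu> i \<and> (i \<notin> I \<longrightarrow> \<mu> i = 0)" for i
      by (metis B_def atLeastAtMost_iff order_refl singletonD)
    with \<mu> show "\<mu> \<in> ?S" by auto
  qed
  moreover have "closed {\<mu> :: 'i \<Rightarrow> real. sum \<mu> I = 1}"
    by (intro closed_Collect_eq continuous_on_sum continuous_on_product_coordinates continuous_on_const)
  ultimately show ?thesis
    using comp by (simp add: compact_Int_closed)
qed

text \<open>The weights minimising the distance from \<open>w\<close> give a point \<open>p\<close> such that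
  \<open>c = p - w\<close> has larger inner product with every \<open>a i\<close> than with \<open>w\<close>, unless \<open>c = 0\<close>.\<close>

lemma convex_combination_if_no_separating_functional:
  fixes a :: "'i \<Rightarrow> 'e \<Rightarrow> real" and w :: "'e \<Rightarrow> real"
  assumes I: "finite I" and E: "finite E"
    and no_sep: "\<And>c. \<exists>i\<in>I. (\<Sum>e\<in>E. c e * a i e) \<le> (\<Sum>e\<in>E. c e * w e)"
  obtains \<mu> where "\<And>i. 0 \<le> \<mu> i" "sum \<mu> I = 1" "\<And>e. e \<in> E \<Longrightarrow> w e = (\<Sum>i\<in>I. \<mu> i * a i e)"
proof -
  define S where "S = {\<mu> :: 'i \<Rightarrow> real. (\<forall>i. 0 \<le> \<mu> i) \<and> (\<forall>i. i \<notin> I \<longrightarrow> \<mu> i = 0) \<and> sum \<mu> I = 1}"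
  define \<delta> where "\<delta> = (\<lambda>i j :: 'i. if j = i then 1 else (0::real))"
  define f where "f = (\<lambda>\<mu>. \<Sum>e\<in>E. ((\<Sum>i\<in>I. \<mu> i * a i e) - w e)\<^sup>2)"
  have \<delta>: "\<delta> i \<in> S" if "i \<in> I" for i
    using that I by (auto simp: S_def \<delta>_def)
  obtain i0 where "i0 \<in> I" using no_sep by blast
  then have "S \<noteq> {}" using \<delta> by blast
  moreover have "continuous_on S (\<lambda>\<mu>. \<mu> i)" for i
    by (rule continuous_on_subset[OF continuous_on_product_coordinates]) simp
  then have "continuous_on S f"
    unfolding f_def by (intro continuous_intros)
  ultimately obtain \<mu> where \<mu>: "\<mu> \<in> S" and min: "\<And>\<nu>. \<nu> \<in> S \<Longrightarrow> f \<mu> \<le> f \<nu>"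
    using continuous_attains_inf[of S f] compact_simplex[OF I] unfolding S_def by blast
  define p where "p = (\<lambda>e. \<Sum>i\<in>I. \<mu> i * a i e)"
  define c where "c = (\<lambda>e. p e - w e)"
  obtain i where i: "i \<in> I" and le: "(\<Sum>e\<in>E. c e * a i e) \<le> (\<Sum>e\<in>E. c e * w e)"
    using no_sep by blast
  define d where "d = (\<lambda>e. a i e - p e)"
  define A where "A = (\<Sum>e\<in>E. c e * d e)"
  define D where "D = (\<Sum>e\<in>E. (d e)\<^sup>2)"
  have fc: "f \<mu> = (\<Sum>e\<in>E. (c e)\<^sup>2)" by (simp add: f_def c_def p_def)
  have D0: "0 \<le> D" unfolding D_def by (simp add: sum_nonneg)
  \<comment> \<open>Moving the weights from \<open>\<mu>\<close> a fraction \<open>s\<close> towards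
    the vertex \<open>\<delta> i\<close> of the simplex moves \<open>p\<close> by \<open>s\<close>
    times \<open>d\<close>. The right-hand side is the resulting change of the squared distance,
    which minimality keeps nonnegative.\<close>
  have step: "0 \<le> 2 * s * A + s\<^sup>2 * D" if s: "0 \<le> s" "s \<le> 1" for s
  proof -
    define \<nu> where "\<nu> = (\<lambda>j. (1 - s) * \<mu> j + s * \<delta> i j)"
    have "\<nu> \<in> S"
      using \<mu> \<delta>[OF i] s
      by (auto simp: S_def \<nu>_def sum.distrib simp flip: sum_distrib_left)
    then have "f \<mu> \<le> f \<nu>" by (rule min)
    have "(\<Sum>j\<in>I. \<nu> j * a j e) = (1 - s) * p e + s * a i e" for e
    proof -
      have "(\<Sum>j\<in>I. \<nu> j * a j e) = (\<Sum>j\<in>I. (1 - s) * (\<mu> j * a j e) + s * (\<delta> i j * a j e))"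
        by (intro sum.cong) (auto simp: \<nu>_def algebra_simps)
      also have "\<dots> = (1 - s) * p e + s * (\<Sum>j\<in>I. \<delta> i j * a j e)"
        by (simp add: sum.distrib p_def sum_distrib_left)
      also have "(\<Sum>j\<in>I. \<delta> i j * a j e) = a i e"
        using i I by (simp add: \<delta>_def if_distrib[of "\<lambda>x. x * _"] cong: if_cong)
      finally show ?thesis .
    qed
    then have "f \<nu> = (\<Sum>e\<in>E. ((1 - s) * p e + s * a i e - w e)\<^sup>2)"
      by (simp add: f_def)
    also have "\<dots> = (\<Sum>e\<in>E. (c e)\<^sup>2 + (2 * s * (c e * d e) + s\<^sup>2 * (d e)\<^sup>2))"
      by (intro sum.cong) (auto simp: c_def d_def power2_eq_square algebra_simps)
    also have "\<dots> = f \<mu> + (2 * s * A + s\<^sup>2 * D)"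
      by (simp add: sum.distrib fc A_def D_def sum_distrib_left)
    finally show ?thesis using \<open>f \<mu> \<le> f \<nu>\<close> by simp
  qed
  have "0 \<le> A"
  proof (rule ccontr)
    assume "\<not> 0 \<le> A"
    \<comment> \<open>So small that the quadratic term is at most \<open>- s * A\<close> and the
      negative linear term wins; the \<open>+ 1\<close> covers \<open>D = 0\<close>.\<close>
    define s where "s = min 1 (- A / (D + 1))"
    have s: "0 < s" "s \<le> 1" using \<open>\<not> 0 \<le> A\<close> D0 by (auto simp: s_def divide_simps)
    have "s * (D + 1) \<le> - A / (D + 1) * (D + 1)"
      using D0 by (intro mult_right_mono) (auto simp: s_def)
    also have "\<dots> = - A" using D0 by simp
    finally have "2 * A + s * D < 0" using s \<open>\<not> 0 \<le> A\<close> by (simp add: algebra_simps)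
    then have "s * (2 * A + s * D) < 0" using s by (simp add: mult_pos_neg)
    then show False using step[of s] s by (simp add: power2_eq_square algebra_simps)
  qed
  \<comment> \<open>Termwise, \<open>a i - p\<close> and \<open>c = p - w\<close> add up to
    \<open>a i - w\<close>.\<close>
  moreover have "A + (\<Sum>e\<in>E. (c e)\<^sup>2) = (\<Sum>e\<in>E. c e * a i e) - (\<Sum>e\<in>E. c e * w e)"
    unfolding A_def sum.distrib[symmetric] sum_subtractf[symmetric]
    by (intro sum.cong) (auto simp: d_def c_def power2_eq_square algebra_simps)
  ultimately have "(\<Sum>e\<in>E. (c e)\<^sup>2) \<le> 0" using le by linarith
  then have "(\<Sum>e\<in>E. (c e)\<^sup>2) = 0" by (intro antisym sum_nonneg) auto
  then have "c e = 0" if "e \<in> E" for e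
    using E that by (simp add: sum_nonneg_eq_0_iff)
  then have "w e = (\<Sum>i\<in>I. \<mu> i * a i e)" if "e \<in> E" for e
    using that by (simp add: c_def p_def)
  with \<mu> that[of \<mu>] show ?thesis by (simp add: S_def)
qed

section \<open>Partitions and their crossing edges\<close>

lemma crossing_edge_endpoints:
  assumes "graph V E" "partition_on V P" "e \<in> crossing_edges E P"
  obtains u w A B where "e = {u, w}" "u \<in> A" "w \<in> B" "A \<in> P" "B \<in> P" "A \<noteq> B" "A \<inter> B = {}"
proof -
  obtain u w A B where *: "u \<in> e" "w \<in> e" "u \<in> A" "w \<in> B" "A \<in> P" "B \<in> P" "A \<noteq> B" "e \<in> E"
    using assms(3) by (auto simp: crossing_edges_def)
  have disj: "A \<inter> B = {}"
    using assms(2) * by (auto dest: partition_onD2 disjointD)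
  have "card e = 2" using assms(1) * by (auto simp: graph_def)
  then have "e = {u, w}"
    using * disj by (auto simp: card_2_iff)
  with * disj that show ?thesis by blast
qed

lemma partition_on_merge:
  assumes "partition_on V P" "A \<in> P" "B \<in> P"
  shows "partition_on V (insert (A \<union> B) (P - {A, B}))"
proof (rule partition_onI)
  show "\<Union> (insert (A \<union> B) (P - {A, B})) = V"
    using assms by (auto simp: partition_on_def)
next
  fix C D assume "C \<in> insert (A \<union> B) (P - {A, B})" "D \<in> insert (A \<union> B) (P - {A, B})" "C \<noteq> D"
  moreover have "X \<inter> Y = {}" if "X \<in> P" "Y \<in> P" "X \<noteq> Y" for X Y
    using assms(1) that by (auto dest: partition_onD2 disjointD)
  ultimately show "disjnt C D" using assms(2,3) unfolding disjnt_def by blast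
next
  show "{} \<notin> insert (A \<union> B) (P - {A, B})"
    using assms by (auto simp: partition_on_def)
qed

text \<open>Endpoints in a common part of the finer partition \<open>P\<close> share a part of
  \<open>Q\<close> as well, so coarsening can only lose crossing edges.\<close>

lemma crossing_edges_antimono:
  assumes "graph V E" "partition_on V P" "partition_on V Q"
    and refine: "\<And>A. A \<in> P \<Longrightarrow> \<exists>B\<in>Q. A \<subseteq> B"
  shows "crossing_edges E Q \<subseteq> crossing_edges E P"
proof
  fix e assume e: "e \<in> crossing_edges E Q"
  obtain u w A B where *: "e = {u, w}" "u \<in> A" "w \<in> B" "A \<in> Q" "B \<in> Q" "A \<noteq> B" "A \<inter> B = {}"
    using crossing_edge_endpoints[OF assms(1,3) e] .
  have eE: "e \<in> E" using e by (simp add: crossing_edges_def)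
  then have "u \<in> V" "w \<in> V" using assms(1) * by (auto simp: graph_def)
  then obtain C D where CD: "C \<in> P" "u \<in> C" "D \<in> P" "w \<in> D"
    using assms(2) by (auto simp: partition_on_def)
  have "C \<noteq> D"
  proof
    assume "C = D"
    then obtain X where "X \<in> Q" "u \<in> X" "w \<in> X" using refine CD by blast
    moreover have "X = A \<or> X \<inter> A = {}" "X = B \<or> X \<inter> B = {}"
      using assms(3) * \<open>X \<in> Q\<close> by (auto dest: partition_onD2 disjointD)
    ultimately show False using * by auto
  qed
  then show "e \<in> crossing_edges E P"
    using eE * CD by (auto simp: crossing_edges_def)
qed

section \<open>Cheap connected subgraphs by contraction\<close>

definition links :: "'v set set \<Rightarrow> ('v \<times> 'v) set" where
  "links F = {(a, b). {a, b} \<in> F}"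

text \<open>Models contraction: vertices of one part count as connected at no cost.\<close>

definition same_part :: "'v set set \<Rightarrow> ('v \<times> 'v) set" where
  "same_part P = {(a, b). \<exists>A\<in>P. a \<in> A \<and> b \<in> A}"

text \<open>Kruskal's algorithm: contract a cheapest crossing edge, of cost \<open>m\<close>, and continue with the
  costs \<open>c - m\<close>. The cost removed is paid for by the partition inequality for \<open>P\<close>.\<close>

lemma kruskal_bound:
  assumes G: "graph V E" "finite E" and "V \<noteq> {}"
    and P: "partition_on V P"
    and w0: "\<And>e. e \<in> E \<Longrightarrow> 0 \<le> w e"
    and cut: "\<And>Q. partition_on V Q \<Longrightarrow> real (card Q) - 1 \<le> (\<Sum>e\<in>crossing_edges E Q. w e)"
    and c0: "\<And>e. e \<in> crossing_edges E P \<Longrightarrow> (0::real) \<le> c e"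
  shows "\<exists>F\<subseteq>E. card F + 1 \<le> card P \<and> sum c F \<le> (\<Sum>e\<in>crossing_edges E P. c e * w e) \<and>
           V \<times> V \<subseteq> (links F \<union> same_part P)\<^sup>*"
  using P c0
proof (induction "card P" arbitrary: P c rule: less_induct)
  case less
  note P = less.prems(1) and c0 = less.prems(2)
  have finP: "finite P" using G(1) P finite_elements by (auto simp: graph_def)
  have "P \<noteq> {}" using P \<open>V \<noteq> {}\<close> by (auto simp: partition_on_def)
  then have "card P \<noteq> 0" using finP by simp
  have fincr: "finite (crossing_edges E Q)" for Q
    using G(2) by (simp add: crossing_edges_def)
  have sub: "crossing_edges E Q \<subseteq> E" for Q by (auto simp: crossing_edges_def)
  show ?case
  proof (cases "card P = 1")
    case True
    then obtain A where "P = {A}" by (auto simp: card_1_singleton_iff)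
    then have "A = V" using P by (auto simp: partition_on_def)
    have "V \<times> V \<subseteq> (links {} \<union> same_part P)\<^sup>*"
      using \<open>P = {A}\<close> \<open>A = V\<close> by (auto simp: same_part_def)
    moreover have "0 \<le> (\<Sum>e\<in>crossing_edges E P. c e * w e)"
      using c0 w0 sub by (intro sum_nonneg mult_nonneg_nonneg) auto
    ultimately show ?thesis using True by (intro exI[of _ "{}"]) auto
  next
    case False
    then have card2: "2 \<le> card P" using \<open>card P \<noteq> 0\<close> by linarith
    \<comment> \<open>With at least two parts the right-hand side of the cut inequality is at least
      1, so the sum is not empty.\<close>
    then have ne: "crossing_edges E P \<noteq> {}"
      using cut[OF P] by auto
    define m where "m = Min (c ` crossing_edges E P)"
    have "m \<in> c ` crossing_edges E P"
      unfolding m_def using ne fincr by (intro Min_in) auto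
    then obtain e where e: "e \<in> crossing_edges E P" and ce: "c e = m" by auto
    have m_le: "m \<le> c e'" if "e' \<in> crossing_edges E P" for e'
      unfolding m_def using that fincr by simp
    have m0: "0 \<le> m" using c0[OF e] ce by simp
    obtain u v A B where *: "e = {u, v}" "u \<in> A" "v \<in> B" "A \<in> P" "B \<in> P" "A \<noteq> B" "A \<inter> B = {}"
      using crossing_edge_endpoints[OF G(1) P e] .
    define Q where "Q = insert (A \<union> B) (P - {A, B})"
    have Q: "partition_on V Q" unfolding Q_def using P * by (intro partition_on_merge)
    \<comment> \<open>Ensures that merging lowers the number of parts by exactly one.\<close>
    have "A \<union> B \<notin> P - {A, B}"
    proof
      assume "A \<union> B \<in> P - {A, B}"
      then have "A \<inter> (A \<union> B) = {}" using P * by (auto dest: partition_onD2 disjointD)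
      then show False using * by auto
    qed
    then have "card Q = Suc (card (P - {A, B}))" using finP by (simp add: Q_def)
    also have "card (P - {A, B}) = card P - 2"
      using * finP by (subst card_Diff_subset) auto
    finally have cardQ: "card Q + 1 = card P" using card2 by simp
    have crQ: "crossing_edges E Q \<subseteq> crossing_edges E P"
      by (rule crossing_edges_antimono[OF G(1) P Q]) (auto simp: Q_def)
    obtain F where F: "F \<subseteq> E" "card F + 1 \<le> card Q"
      and cost: "(\<Sum>e\<in>F. c e - m) \<le> (\<Sum>e\<in>crossing_edges E Q. (c e - m) * w e)"
      and conn: "V \<times> V \<subseteq> (links F \<union> same_part Q)\<^sup>*"
      \<comment> \<open>The reduced cost \<open>c - m\<close> can be negative inside a part, hence
        nonnegativity is asked of crossing edges only. Those of \<open>Q\<close> also cross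
        \<open>P\<close> and so cost at least \<open>m\<close>.\<close>
      using less.hyps[OF _ Q, of "\<lambda>e. c e - m"] cardQ m_le crQ by fastforce
    have finF: "finite F" using F G(2) finite_subset by blast
    have eE: "e \<in> E" using e sub by blast
    define R where "R = (links (insert e F) \<union> same_part P)\<^sup>*"
    \<comment> \<open>An inequality, since \<open>e\<close> might already lie in \<open>F\<close>;
      then \<open>m \<ge> 0\<close> is used.\<close>
    have "sum c (insert e F) \<le> m + sum c F"
      using finF ce m0 by (cases "e \<in> F") (auto simp: insert_absorb)
    also have "\<dots> = (\<Sum>e\<in>F. c e - m) + m * (real (card F) + 1)"
      by (simp add: sum_subtractf algebra_simps)
    also have "\<dots> \<le> (\<Sum>e\<in>crossing_edges E Q. (c e - m) * w e) + m * (real (card P) - 1)"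
      using cost m0 F(2) cardQ by (intro add_mono mult_left_mono) linarith+
    also have "\<dots> \<le> (\<Sum>e\<in>crossing_edges E P. (c e - m) * w e) + m * (\<Sum>e\<in>crossing_edges E P. w e)"
      using crQ fincr m_le w0 subsetD[OF sub] m0 cut[OF P]
      by (intro add_mono sum_mono2 mult_left_mono mult_nonneg_nonneg) auto
    also have "\<dots> = (\<Sum>e\<in>crossing_edges E P. c e * w e)"
      unfolding sum_distrib_left sum.distrib[symmetric]
      by (intro sum.cong) (auto simp: algebra_simps)
    finally have total: "sum c (insert e F) \<le> (\<Sum>e\<in>crossing_edges E P. c e * w e)" .
    have part: "(a, b) \<in> R" if "C \<in> P" "a \<in> C" "b \<in> C" for a b C
      using that unfolding R_def same_part_def by blast
    have uv: "(u, v) \<in> R" "(v, u) \<in> R"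
      using * unfolding R_def links_def by (auto simp: insert_commute intro: r_into_rtrancl)
    have trans: "(a, b) \<in> R \<Longrightarrow> (b, d) \<in> R \<Longrightarrow> (a, d) \<in> R" for a b d
      unfolding R_def by (rule rtrancl_trans)
    \<comment> \<open>Only the merged part is new; the edge \<open>e = {u, v}\<close> joins its
      halves \<open>A\<close> and \<open>B\<close>.\<close>
    have "same_part Q \<subseteq> R"
    proof (clarsimp simp: same_part_def)
      fix a b C assume C: "C \<in> Q" "a \<in> C" "b \<in> C"
      show "(a, b) \<in> R"
      proof (cases "C = A \<union> B")
        case True
        have "(a, u) \<in> R" if "a \<in> A \<union> B" for a
          using that part[of A a u] part[of B a v] uv * trans by blast
        moreover have "(u, b) \<in> R" if "b \<in> A \<union> B" for b
          using that part[of A u b] part[of B v b] uv * trans by blast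
        ultimately show ?thesis using C True trans by blast
      next
        case False
        then show ?thesis using C part[of C] by (auto simp: Q_def)
      qed
    qed
    moreover have "links F \<subseteq> R" by (auto simp: R_def links_def)
    ultimately have "(links F \<union> same_part Q)\<^sup>* \<subseteq> R"
      by (metis R_def Un_least rtrancl_subset_rtrancl)
    with conn have "V \<times> V \<subseteq> R" by blast
    moreover have "card (insert e F) + 1 \<le> card P"
      using F(2) cardQ finF by (simp add: card_insert_if)
    ultimately show ?thesis
      using total F(1) eE unfolding R_def by (intro exI[of _ "insert e F"]) auto
  qed
qed

text \<open>Start the contraction from singletons, where \<open>same_part\<close> adds only loops
  and \<open>F\<close> alone must connect \<open>V\<close>.\<close>

corollary connected_subgraph_cost_le:
  assumes G: "graph V E" "finite E"
    and w0: "\<And>e. e \<in> E \<Longrightarrow> 0 \<le> w e"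
    and cut: "\<And>Q. partition_on V Q \<Longrightarrow> real (card Q) - 1 \<le> (\<Sum>e\<in>crossing_edges E Q. w e)"
    and c0: "\<And>e. e \<in> E \<Longrightarrow> (0::real) \<le> c e"
  obtains F where "F \<subseteq> E" "sum c F \<le> (\<Sum>e\<in>E. c e * w e)" "V \<times> V \<subseteq> (links F)\<^sup>*"
proof (cases "V = {}")
  case True
  then show ?thesis using that[of "{}"] w0 c0 by (simp add: sum_nonneg)
next
  case False
  let ?P = "(\<lambda>v. {v}) ` V"
  have P: "partition_on V ?P"
    by (rule partition_onI) (auto simp: disjnt_def)
  have sub: "crossing_edges E ?P \<subseteq> E" by (auto simp: crossing_edges_def)
  obtain F where F: "F \<subseteq> E" "sum c F \<le> (\<Sum>e\<in>crossing_edges E ?P. c e * w e)"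
    "V \<times> V \<subseteq> (links F \<union> same_part ?P)\<^sup>*"
    using kruskal_bound[OF G False P w0 cut, of c] c0 sub by blast
  have "(\<Sum>e\<in>crossing_edges E ?P. c e * w e) \<le> (\<Sum>e\<in>E. c e * w e)"
    using G(2) sub w0 c0 by (intro sum_mono2) auto
  moreover have "same_part ?P \<subseteq> Id" by (auto simp: same_part_def)
  then have "(links F \<union> same_part ?P)\<^sup>* \<subseteq> (links F)\<^sup>*"
    by (intro rtrancl_subset_rtrancl) auto
  ultimately show ?thesis using that F by (meson order_trans)
qed

section \<open>Tours and vertex parity\<close>

text \<open>Touching \<open>v\<close> follows from connectivity: a path to another vertex starts
  with an edge at \<open>v\<close>.\<close>

lemma euler_tourI:
  assumes conn: "V \<times> V \<subseteq> (multigraph_adj E \<chi>)\<^sup>*"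
    and even: "\<And>v. v \<in> V \<Longrightarrow> even (multigraph_degree E \<chi> v)"
  shows "euler_tour V E \<chi>"
proof -
  have "\<exists>e\<in>incident_edges E v. \<chi> e > 0" if v: "v \<in> V" "V \<noteq> {v}" for v
  proof -
    obtain u where "u \<in> V" "u \<noteq> v" using v by auto
    then have "(v, u) \<in> (multigraph_adj E \<chi>)\<^sup>*" using conn v by auto
    then show ?thesis
      using \<open>u \<noteq> v\<close>
      by (cases rule: converse_rtranclE) (auto simp: multigraph_adj_def incident_edges_def)
  qed
  then show ?thesis using assms unfolding euler_tour_def by blast
qed

text \<open>The case \<open>F = {e \<in> incident_edges E v. y e = 1}\<close> of the parity constraint (4.2).\<close>

lemma even_card_incident_ones:
  fixes y :: "'v set \<Rightarrow> real"
  assumes "finite E"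
    and par: "\<And>F. F \<subseteq> incident_edges E v \<Longrightarrow> odd (card F) \<Longrightarrow>
           (\<Sum>e\<in>F. 1 - y e) + (\<Sum>e\<in>incident_edges E v - F. y e) \<ge> 1"
    and y: "\<And>e. e \<in> E \<Longrightarrow> y e \<in> {0, 1}"
  shows "even (card {e \<in> incident_edges E v. y e = 1})" (is "even (card ?F)")
proof (rule ccontr)
  assume "odd (card ?F)"
  then have "(\<Sum>e\<in>?F. 1 - y e) + (\<Sum>e\<in>incident_edges E v - ?F. y e) \<ge> 1"
    by (intro par) auto
  moreover have "(\<Sum>e\<in>?F. 1 - y e) = 0" by (intro sum.neutral) auto
  moreover have "(\<Sum>e\<in>incident_edges E v - ?F. y e) = 0"
    using y by (intro sum.neutral) (auto simp: incident_edges_def)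
  ultimately show False by simp
qed

section \<open>Decomposing \<open>x\<close> into tours\<close>

theorem theorem1:
  fixes V :: "'v set" and E :: "'v set set"
    and x y z t :: "'v set \<Rightarrow> real"
  assumes "graph V E"
    and "\<forall>e\<in>E. x e = y e + 2 * z e"
    and "\<forall>v\<in>V. \<forall>F. F \<subseteq> incident_edges E v \<and> odd (card F) \<longrightarrow>
           (\<Sum>e\<in>F. 1 - y e) + (\<Sum>e\<in>incident_edges E v - F. y e) \<ge> 1"
    and "\<forall>P. partition_on V P \<longrightarrow>
           (\<Sum>e\<in>crossing_edges E P. t e) \<ge> real (card P) - 1"
    and "\<forall>e\<in>E. t e \<le> y e + z e \<and> y e + z e \<le> 1"
    and "\<forall>e\<in>E. 0 \<le> t e \<and> t e \<le> 1"
    and "\<forall>e\<in>E. 0 \<le> z e \<and> z e \<le> 1"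
    and "\<forall>e\<in>E. y e \<in> {0, 1}"
  shows "is_euler_tour_vector V E x \<or> is_convex_comb_of_euler_tours V E x"
proof -
  have "E \<subseteq> Pow V" "finite V" using assms(1) by (auto simp: graph_def)
  then have finE: "finite E" by (simp add: finite_subset)
  define w where "w = (\<lambda>e. y e + z e)"
  define Y where "Y = {e \<in> E. y e = 1}"
  define k where "k = (\<lambda>e. if e \<in> Y then 1 else (2::nat))"
  define \<chi> where "\<chi> = (\<lambda>C e. if e \<in> C then k e else 0)"
  define T where "T = \<chi> ` {C. C \<subseteq> E \<and> Y \<subseteq> C \<and> V \<times> V \<subseteq> (links C)\<^sup>*}"
  have "T \<subseteq> \<chi> ` Pow E" unfolding T_def by blast
  then have finT: "finite T" by (rule finite_subset) (simp add: finE)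
  have w0: "0 \<le> w e" and w1: "w e \<le> 1" if "e \<in> E" for e
    using bspec[OF assms(5) that] bspec[OF assms(6) that] by (auto simp: w_def)
  have wY: "w e = 1" if "e \<in> Y" for e
    using that bspec[OF assms(5), of e] bspec[OF assms(7), of e] by (auto simp: w_def Y_def)
  \<comment> \<open>On \<open>Y\<close>, \<open>w = 1\<close> forces \<open>z = 0\<close>, so
    \<open>x = 1\<close>; elsewhere \<open>y = 0\<close> and
    \<open>x = 2 * z = 2 * w\<close>.\<close>
  have xw: "x e = real (k e) * w e" if "e \<in> E" for e
    using that bspec[OF assms(2) that] bspec[OF assms(8) that] wY[of e]
    by (auto simp: w_def Y_def k_def)
  have cut: "real (card Q) - 1 \<le> (\<Sum>e\<in>crossing_edges E Q. w e)" if "partition_on V Q" for Q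
  proof -
    have "(\<Sum>e\<in>crossing_edges E Q. t e) \<le> (\<Sum>e\<in>crossing_edges E Q. w e)"
      using assms(5) by (intro sum_mono) (auto simp: w_def crossing_edges_def)
    moreover have "real (card Q) - 1 \<le> (\<Sum>e\<in>crossing_edges E Q. t e)"
      using assms(4) that by blast
    ultimately show ?thesis by linarith
  qed
  have tours: "euler_tour V E X" if XT: "X \<in> T" for X
  proof -
    obtain C where C: "C \<subseteq> E" "Y \<subseteq> C" "V \<times> V \<subseteq> (links C)\<^sup>*" and X: "X = \<chi> C"
      using XT unfolding T_def by blast
    show ?thesis
    proof (rule euler_tourI)
      have "links C \<subseteq> multigraph_adj E X"
        using C(1) by (auto simp: links_def multigraph_adj_def X \<chi>_def k_def)
      then show "V \<times> V \<subseteq> (multigraph_adj E X)\<^sup>*"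
        using C(3) by (meson order_trans rtrancl_mono)
    next
      fix v assume v: "v \<in> V"
      have fin: "finite (incident_edges E v)" using finE by (simp add: incident_edges_def)
      \<comment> \<open>Edges of \<open>C - Y\<close> have multiplicity 2 and do not affect
        parity.\<close>
      have "{e \<in> incident_edges E v. odd (X e)} = {e \<in> incident_edges E v. y e = 1}"
        using C(2) by (auto simp: X \<chi>_def k_def Y_def incident_edges_def)
      moreover have "even (card {e \<in> incident_edges E v. y e = 1})"
        using bspec[OF assms(3) v] bspec[OF assms(8)]
        by (intro even_card_incident_ones[OF finE]) auto
      ultimately show "even (multigraph_degree E X v)"
        unfolding multigraph_degree_def using even_sum_iff[OF fin, of X] by simp
    qed
  qed
  have no_sep: "\<exists>X\<in>T. (\<Sum>e\<in>E. c e * real (X e)) \<le> (\<Sum>e\<in>E. c e * x e)" for c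
  proof -
    define d where "d = (\<lambda>e. c e * real (k e))"
    \<comment> \<open>The contraction bound requires nonnegative costs. Edges of \<open>Y\<close>
      must be in \<open>C\<close> anyway and edges with \<open>d e \<le> 0\<close> are worth adding,
      so both become free; \<open>d - d'\<close> records their true cost.\<close>
    define d' where "d' = (\<lambda>e. if e \<in> Y then 0 else max 0 (d e))"
    have d'0: "0 \<le> d' e" if "e \<in> E" for e by (simp add: d'_def)
    obtain F where F: "F \<subseteq> E" "sum d' F \<le> (\<Sum>e\<in>E. d' e * w e)" "V \<times> V \<subseteq> (links F)\<^sup>*"
      using connected_subgraph_cost_le[OF assms(1) finE w0 cut d'0] .
    define C where "C = F \<union> Y \<union> {e \<in> E. d e \<le> 0}"
    have "links F \<subseteq> links C" by (auto simp: links_def C_def)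
    then have "V \<times> V \<subseteq> (links C)\<^sup>*" using F(3) by (meson order_trans rtrancl_mono)
    moreover have "C \<subseteq> E" "Y \<subseteq> C" using F(1) by (auto simp: C_def Y_def)
    ultimately have "\<chi> C \<in> T" unfolding T_def by (intro imageI CollectI conjI)
    have "(\<Sum>e\<in>E. c e * real (\<chi> C e)) = (\<Sum>e\<in>E. (if e \<in> F then d' e else 0) + (d e - d' e))"
      by (intro sum.cong) (auto simp: \<chi>_def C_def d'_def d_def max_def)
    also have "\<dots> = sum d' F + (\<Sum>e\<in>E. d e - d' e)"
      using F(1) finE by (simp add: sum.distrib sum.inter_restrict[symmetric] Int_absorb1)
    also have "\<dots> \<le> (\<Sum>e\<in>E. d' e * w e) + (\<Sum>e\<in>E. d e - d' e)"
      using F(2) by simp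
    also have "\<dots> = (\<Sum>e\<in>E. d' e * w e + (d e - d' e))"
      by (simp add: sum.distrib)
    also have "\<dots> \<le> (\<Sum>e\<in>E. c e * x e)"
    proof (rule sum_mono)
      fix e assume e: "e \<in> E"
      \<comment> \<open>Taking an edge of nonpositive cost fully is at least as cheap as the
        fraction \<open>w e \<le> 1\<close>. On \<open>Y\<close> the two agree because
        \<open>w e = 1\<close>.\<close>
      have "d e \<le> d e * w e" if "d e \<le> 0"
        using mult_left_mono_neg[OF w1[OF e] that] by simp
      then have "d' e * w e + (d e - d' e) \<le> d e * w e"
        using wY by (auto simp: d'_def max_def)
      then show "d' e * w e + (d e - d' e) \<le> c e * x e"
        using xw[OF e] by (simp add: d_def mult.assoc)
    qed
    finally show ?thesis using \<open>\<chi> C \<in> T\<close> by blast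
  qed
  obtain \<mu> where "\<And>X. 0 \<le> \<mu> X" "sum \<mu> T = 1" "\<And>e. e \<in> E \<Longrightarrow> x e = (\<Sum>X\<in>T. \<mu> X * real (X e))"
    using convex_combination_if_no_separating_functional[OF finT finE no_sep] by blast
  then have "is_convex_comb_of_euler_tours V E x"
    unfolding is_convex_comb_of_euler_tours_def using finT tours by blast
  then show ?thesis ..
qed

end
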